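(* (a) If $\langle M,\in\rangle$ is an uncountable transitive model of ZFC, then $\langle M,\subseteq\rangle$ is not saturated. (b) More generally, let $\langle M,\in^M\rangle$ be a model of KP, and suppose there is $w\in M$ such that the set $\{a\in M\mid a\in^M w\}$ is countably infinite. Then $\langle M,\subseteq^M\rangle$ is not $\omega_1$-saturated.
   Context: For $\langle M,\in^M\rangle$, $a\subseteq^M b$ iff for all $c\in M$, $c\in^M a\Rightarrow c\in^M b$. A structure $M$ is saturated if every 1-type over fewer than $|M|$ parameters finitely satisfiable in $M$ is realized in $M$; $\omega_1$-saturated means every 1-type over countably many parameters finitely satisfiable in $M$ is realized. KP is Kripke–Platek set theory. *)

theory Defs
  imports "HOL-Library.Countable_Set" "HOL-Library.Equipollence"
begin

section \<open>First-order logic with one binary relation symbol\<close>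

text \<open>
  Formulas may mention elements of type \<open>'a\<close> as parameters; \<open>params \<phi>\<close> is the set of
  parameters occurring in \<open>\<phi>\<close>. Variables are natural numbers. The relation symbol is
  interpreted by membership for the theories below, and by inclusion for \<open>\<langle>M, \<subseteq>\<rangle>\<close>.
\<close>

datatype (tparams: 'a) trm = Var nat | Par 'a

datatype (params: 'a) fm =
    Rel "'a trm" "'a trm"
  | Equ "'a trm" "'a trm"
  | Neg "'a fm"
  | Conj "'a fm" "'a fm"
  | Exists nat "'a fm"

fun tvars :: "'a trm \<Rightarrow> nat set" where
  "tvars (Var n) = {n}"
| "tvars (Par a) = {}"

fun fv :: "'a fm \<Rightarrow> nat set" where
  "fv (Rel s t) = tvars s \<union> tvars t"
| "fv (Equ s t) = tvars s \<union> tvars t"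
| "fv (Neg \<phi>) = fv \<phi>"
| "fv (Conj \<phi> \<psi>) = fv \<phi> \<union> fv \<psi>"
| "fv (Exists x \<phi>) = fv \<phi> - {x}"

fun tval :: "(nat \<Rightarrow> 'a) \<Rightarrow> 'a trm \<Rightarrow> 'a" where
  "tval \<sigma> (Var n) = \<sigma> n"
| "tval \<sigma> (Par a) = a"

fun sat :: "'a set \<Rightarrow> ('a \<Rightarrow> 'a \<Rightarrow> bool) \<Rightarrow> (nat \<Rightarrow> 'a) \<Rightarrow> 'a fm \<Rightarrow> bool" where
  "sat M R \<sigma> (Rel s t) \<longleftrightarrow> R (tval \<sigma> s) (tval \<sigma> t)"
| "sat M R \<sigma> (Equ s t) \<longleftrightarrow> tval \<sigma> s = tval \<sigma> t"
| "sat M R \<sigma> (Neg \<phi>) \<longleftrightarrow> \<not> sat M R \<sigma> \<phi>"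
| "sat M R \<sigma> (Conj \<phi> \<psi>) \<longleftrightarrow> sat M R \<sigma> \<phi> \<and> sat M R \<sigma> \<psi>"
| "sat M R \<sigma> (Exists x \<phi>) \<longleftrightarrow> (\<exists>a\<in>M. sat M R (\<sigma>(x := a)) \<phi>)"

text \<open>Open formulas in \<open>T\<close> stand for their universal closures.\<close>

definition models :: "'a set \<Rightarrow> ('a \<Rightarrow> 'a \<Rightarrow> bool) \<Rightarrow> 'a fm set \<Rightarrow> bool" where
  "models M R T \<longleftrightarrow> M \<noteq> {} \<and> (\<forall>\<phi>\<in>T. \<forall>\<sigma>. range \<sigma> \<subseteq> M \<longrightarrow> sat M R \<sigma> \<phi>)"

abbreviation Disj :: "'a fm \<Rightarrow> 'a fm \<Rightarrow> 'a fm" where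
  "Disj \<phi> \<psi> \<equiv> Neg (Conj (Neg \<phi>) (Neg \<psi>))"
abbreviation Imp :: "'a fm \<Rightarrow> 'a fm \<Rightarrow> 'a fm" where
  "Imp \<phi> \<psi> \<equiv> Neg (Conj \<phi> (Neg \<psi>))"
abbreviation Iff :: "'a fm \<Rightarrow> 'a fm \<Rightarrow> 'a fm" where
  "Iff \<phi> \<psi> \<equiv> Conj (Imp \<phi> \<psi>) (Imp \<psi> \<phi>)"
abbreviation Forall :: "nat \<Rightarrow> 'a fm \<Rightarrow> 'a fm" where
  "Forall x \<phi> \<equiv> Neg (Exists x (Neg \<phi>))"
abbreviation Mem :: "nat \<Rightarrow> nat \<Rightarrow> 'a fm" (infix "\<^bold>\<in>" 70) where
  "x \<^bold>\<in> y \<equiv> Rel (Var x) (Var y)"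
abbreviation EqV :: "nat \<Rightarrow> nat \<Rightarrow> 'a fm" (infix "\<^bold>=" 70) where
  "x \<^bold>= y \<equiv> Equ (Var x) (Var y)"
abbreviation BEx :: "nat \<Rightarrow> nat \<Rightarrow> 'a fm \<Rightarrow> 'a fm" where
  "BEx x y \<phi> \<equiv> Exists x (Conj (x \<^bold>\<in> y) \<phi>)"
abbreviation BAll :: "nat \<Rightarrow> nat \<Rightarrow> 'a fm \<Rightarrow> 'a fm" where
  "BAll x y \<phi> \<equiv> Forall x (Imp (x \<^bold>\<in> y) \<phi>)"


section \<open>The theories ZFC and KP\<close>

text \<open>
  Pairing, union and power set are stated with an inclusion, as is common; the exact sets
  are then obtained by (for KP: \<open>\<Delta>\<^sub>0\<close>-)separation.
\<close>

definition Extensionality :: "'a fm" where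
  "Extensionality = Imp (Forall 2 (Iff (2 \<^bold>\<in> 0) (2 \<^bold>\<in> 1))) (0 \<^bold>= 1)"

definition Foundation :: "'a fm" where
  "Foundation = Imp (Exists 1 (1 \<^bold>\<in> 0)) (BEx 1 0 (Neg (Exists 2 (Conj (2 \<^bold>\<in> 1) (2 \<^bold>\<in> 0)))))"

definition Pairing :: "'a fm" where
  "Pairing = Exists 2 (Conj (0 \<^bold>\<in> 2) (1 \<^bold>\<in> 2))"

definition Union_ax :: "'a fm" where
  "Union_ax = Exists 1 (BAll 2 0 (BAll 3 2 (3 \<^bold>\<in> 1)))"

definition Power_set :: "'a fm" where
  "Power_set = Exists 1 (Forall 2 (Imp (BAll 3 2 (3 \<^bold>\<in> 0)) (2 \<^bold>\<in> 1)))"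

definition Infinity :: "'a fm" where
  "Infinity = Exists 0 (Conj
     (BEx 1 0 (Forall 2 (Neg (2 \<^bold>\<in> 1))))
     (BAll 1 0 (BEx 2 0 (Forall 3 (Iff (3 \<^bold>\<in> 2) (Disj (3 \<^bold>\<in> 1) (3 \<^bold>= 1)))))))"

text \<open>Every set of nonempty, pairwise disjoint sets has a set meeting each of them in exactly
  one element.\<close>

definition Choice :: "'a fm" where
  "Choice = Imp
     (Conj (BAll 1 0 (Exists 2 (2 \<^bold>\<in> 1)))
        (BAll 1 0 (BAll 2 0 (Imp (Exists 3 (Conj (3 \<^bold>\<in> 1) (3 \<^bold>\<in> 2))) (1 \<^bold>= 2)))))
     (Exists 4 (BAll 1 0 (Exists 2 (Forall 3 (Iff (Conj (3 \<^bold>\<in> 1) (3 \<^bold>\<in> 4)) (3 \<^bold>= 2))))))"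

text \<open>\<open>\<exists>b \<forall>x (x \<in> b \<longleftrightarrow> x \<in> a \<and> \<phi>)\<close>\<close>

definition Separation :: "'a fm set \<Rightarrow> 'a fm set" where
  "Separation \<Phi> = {Exists b (Forall x (Iff (x \<^bold>\<in> b) (Conj (x \<^bold>\<in> a) \<phi>))) | a b x \<phi>.
     \<phi> \<in> \<Phi> \<and> distinct [a, b, x] \<and> b \<notin> fv \<phi>}"

text \<open>\<open>\<forall>x\<in>a \<exists>!y \<phi> \<longrightarrow> \<exists>b \<forall>x\<in>a \<exists>y\<in>b \<phi>\<close>, with \<open>\<exists>!y \<phi>\<close> written as
  \<open>\<exists>u \<forall>y (\<phi> \<longleftrightarrow> y = u)\<close>\<close>

definition Replacement :: "'a fm set \<Rightarrow> 'a fm set" where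
  "Replacement \<Phi> = {Imp (BAll x a (Exists u (Forall y (Iff \<phi> (y \<^bold>= u)))))
       (Exists b (BAll x a (BEx y b \<phi>))) | a b x y u \<phi>.
     \<phi> \<in> \<Phi> \<and> distinct [a, b, x, y, u] \<and> b \<notin> fv \<phi> \<and> u \<notin> fv \<phi>}"

text \<open>\<open>\<forall>x\<in>a \<exists>y \<phi> \<longrightarrow> \<exists>b \<forall>x\<in>a \<exists>y\<in>b \<phi>\<close>\<close>

definition Collection :: "'a fm set \<Rightarrow> 'a fm set" where
  "Collection \<Phi> = {Imp (BAll x a (Exists y \<phi>)) (Exists b (BAll x a (BEx y b \<phi>))) | a b x y \<phi>.
     \<phi> \<in> \<Phi> \<and> distinct [a, b, x, y] \<and> b \<notin> fv \<phi>}"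

text \<open>\<open>\<exists>x \<phi>(x) \<longrightarrow> \<exists>z (\<phi>(z) \<and> \<forall>x\<in>z \<not>\<phi>(x))\<close>, with \<open>\<phi>(z)\<close> written as
  \<open>\<exists>x (x = z \<and> \<phi>(x))\<close> to avoid substitution\<close>

definition Foundation_schema :: "'a fm set \<Rightarrow> 'a fm set" where
  "Foundation_schema \<Phi> = {Imp (Exists x \<phi>)
       (Exists z (Conj (Exists x (Conj (x \<^bold>= z) \<phi>)) (BAll x z (Neg \<phi>)))) | x z \<phi>.
     \<phi> \<in> \<Phi> \<and> x \<noteq> z \<and> z \<notin> fv \<phi>}"

text \<open>Axioms are formulas of the pure language of set theory, hence parameter-free.\<close>

definition pure_fms :: "'a fm set" where
  "pure_fms = {\<phi>. params \<phi> = {}}"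

inductive_set Delta0 :: "'a fm set" where
  "x \<^bold>\<in> y \<in> Delta0"
| "x \<^bold>= y \<in> Delta0"
| "\<phi> \<in> Delta0 \<Longrightarrow> Neg \<phi> \<in> Delta0"
| "\<phi> \<in> Delta0 \<Longrightarrow> \<psi> \<in> Delta0 \<Longrightarrow> Conj \<phi> \<psi> \<in> Delta0"
| "\<phi> \<in> Delta0 \<Longrightarrow> x \<noteq> y \<Longrightarrow> BEx x y \<phi> \<in> Delta0"
| "\<phi> \<in> Delta0 \<Longrightarrow> x \<noteq> y \<Longrightarrow> BAll x y \<phi> \<in> Delta0"

definition ZFC :: "'a fm set" where
  "ZFC = {Extensionality, Foundation, Pairing, Union_ax, Power_set, Infinity, Choice}
     \<union> Separation pure_fms \<union> Replacement pure_fms"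

text \<open>Following Barwise, KP has the full foundation schema and no axiom of infinity.\<close>

definition KP :: "'a fm set" where
  "KP = {Extensionality, Pairing, Union_ax} \<union> Foundation_schema pure_fms
     \<union> Separation Delta0 \<union> Collection Delta0"


section \<open>Types and saturation\<close>

definition one_type_over :: "'a set \<Rightarrow> 'a fm set \<Rightarrow> bool" where
  "one_type_over A p \<longleftrightarrow> (\<forall>\<phi>\<in>p. fv \<phi> \<subseteq> {0} \<and> params \<phi> \<subseteq> A)"

text \<open>Variable 0 is the variable of the type; the values of the other variables are
  irrelevant, so a constant assignment is used.\<close>

definition realizes :: "'a set \<Rightarrow> ('a \<Rightarrow> 'a \<Rightarrow> bool) \<Rightarrow> 'a fm set \<Rightarrow> 'a \<Rightarrow> bool" where
  "realizes M R p x \<longleftrightarrow> (\<forall>\<phi>\<in>p. sat M R (\<lambda>_. x) \<phi>)"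

definition finitely_satisfiable :: "'a set \<Rightarrow> ('a \<Rightarrow> 'a \<Rightarrow> bool) \<Rightarrow> 'a fm set \<Rightarrow> bool" where
  "finitely_satisfiable M R p \<longleftrightarrow> (\<forall>q. finite q \<and> q \<subseteq> p \<longrightarrow> (\<exists>x\<in>M. realizes M R q x))"

definition saturated :: "'a set \<Rightarrow> ('a \<Rightarrow> 'a \<Rightarrow> bool) \<Rightarrow> bool" where
  "saturated M R \<longleftrightarrow> (\<forall>A p. A \<subseteq> M \<and> A \<prec> M \<and> one_type_over A p \<and> finitely_satisfiable M R p
     \<longrightarrow> (\<exists>x\<in>M. realizes M R p x))"

definition omega1_saturated :: "'a set \<Rightarrow> ('a \<Rightarrow> 'a \<Rightarrow> bool) \<Rightarrow> bool" where
  "omega1_saturated M R \<longleftrightarrow> (\<forall>A p. A \<subseteq> M \<and> countable A \<and> one_type_over A p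
     \<and> finitely_satisfiable M R p \<longrightarrow> (\<exists>x\<in>M. realizes M R p x))"


section \<open>Inclusion and transitive sets\<close>

definition incl :: "'a set \<Rightarrow> ('a \<Rightarrow> 'a \<Rightarrow> bool) \<Rightarrow> 'a \<Rightarrow> 'a \<Rightarrow> bool" where
  "incl M E a b \<longleftrightarrow> (\<forall>c\<in>M. E c a \<longrightarrow> E c b)"

text \<open>
  HOL has no type of all sets. The ambient universe in which a transitive set lives is an
  arbitrary type with a well-founded extensional membership relation; this covers every
  genuine transitive set (with the true membership relation).
\<close>

definition set_universe :: "('v \<Rightarrow> 'v \<Rightarrow> bool) \<Rightarrow> bool" where
  "set_universe mem \<longleftrightarrow> wfp mem \<and> (\<forall>x y. (\<forall>z. mem z x \<longleftrightarrow> mem z y) \<longrightarrow> x = y)"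

definition transitive_set :: "('v \<Rightarrow> 'v \<Rightarrow> bool) \<Rightarrow> 'v set \<Rightarrow> bool" where
  "transitive_set mem M \<longleftrightarrow> (\<forall>x\<in>M. \<forall>y. mem y x \<longrightarrow> y \<in> M)"

end

theory Submission
  imports Defs
begin

text \<open>
  If \<open>w\<close> has countably infinitely many elements, then the type saying that \<open>x\<close> is a nonempty
  subset of \<open>w\<close> including none of the singletons \<open>{a}\<close> with \<open>a \<in> w\<close> has countably many
  parameters, is finitely satisfied by singletons, and is not realized. For (a), such a \<open>w\<close> is
  the set of natural numbers of \<open>M\<close>, which is standard because membership is well-founded:
  by \<open>\<in>\<close>-induction, \<open>x\<close> is a standard natural number as soon as \<open>x\<close> and each of its elements
  are zero or a successor.
\<close>

lemma omitted_type:
  assumes w: "w \<in> M" "countable {a \<in> M. E a w}" "infinite {a \<in> M. E a w}"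
    and e: "e \<in> M" "\<And>c. c \<in> M \<Longrightarrow> \<not> E c e"
    and s: "\<And>a. a \<in> M \<Longrightarrow> s a \<in> M" "\<And>a c. a \<in> M \<Longrightarrow> c \<in> M \<Longrightarrow> E c (s a) \<longleftrightarrow> c = a"
  obtains A p where "A \<subseteq> M" "countable A" "one_type_over A p"
    "finitely_satisfiable M (incl M E) p" "\<And>x. x \<in> M \<Longrightarrow> \<not> realizes M (incl M E) p x"
proof -
  define W where "W = {a \<in> M. E a w}"
  define f where "f a = Neg (Rel (Par (s a)) (Var 0))" for a
  define p where "p = insert (Rel (Var 0) (Par w)) (insert (Neg (Rel (Var 0) (Par e))) (f ` W))"
  have WM: "W \<subseteq> M" by (auto simp: W_def)
  \<comment> \<open>Including a singleton amounts to having its element, so each \<open>f a\<close>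
    says that \<open>a\<close> is not an element of \<open>x\<close>. As \<open>e\<close> is empty,
    not being included in \<open>e\<close> means being nonempty.\<close>
  have incl_s: "incl M E (s a) x \<longleftrightarrow> E a x" if "a \<in> M" for a x
    using s that by (auto simp: incl_def)
  have inj: "inj_on f W"
  proof (rule inj_onI)
    fix a b assume "a \<in> W" "b \<in> W" "f a = f b"
    moreover from this have "s a = s b" by (simp add: f_def)
    ultimately show "a = b" using WM s by (metis subsetD)
  qed
  show thesis
  proof (rule that)
    show "insert w (insert e (s ` W)) \<subseteq> M" using w e s WM by auto
    show "countable (insert w (insert e (s ` W)))" using w by (simp add: W_def)
    show "one_type_over (insert w (insert e (s ` W))) p"
      by (auto simp: one_type_over_def p_def f_def)
    show "finitely_satisfiable M (incl M E) p"
      unfolding finitely_satisfiable_def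
    proof (intro allI impI)
      fix q assume q: "finite q \<and> q \<subseteq> p"
      \<comment> \<open>By injectivity of \<open>f\<close>, the finite \<open>q\<close> omits
        \<open>f a\<close> for some \<open>a\<close>. Then \<open>s a\<close> realizes
        \<open>q\<close>: it is a nonempty subset of \<open>w\<close>, and it includes
        \<open>s b\<close> only for \<open>b = a\<close>.\<close>
      have "infinite (f ` W)" using inj w by (simp add: W_def finite_image_iff)
      then obtain a where a: "a \<in> W" "f a \<notin> q" using q by (meson finite_subset image_subsetI)
      have aM: "a \<in> M" using a WM by auto
      have "sat M (incl M E) (\<lambda>_. s a) \<phi>" if \<phi>: "\<phi> \<in> q" for \<phi>
      proof -
        consider "\<phi> = Rel (Var 0) (Par w)" | "\<phi> = Neg (Rel (Var 0) (Par e))"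
          | b where "b \<in> W" "\<phi> = f b"
          using q \<phi> by (auto simp: p_def)
        then show ?thesis
        proof cases
          case 1 then show ?thesis using a by (simp add: incl_s aM) (simp add: W_def)
        next
          case 2 then show ?thesis using e aM by (simp add: incl_s)
        next
          case 3
          then have "b \<in> M" "b \<noteq> a" using WM a \<phi> by auto
          then show ?thesis using 3 s aM by (simp add: f_def incl_s)
        qed
      qed
      then show "\<exists>x\<in>M. realizes M (incl M E) q x"
        using s aM by (auto simp: realizes_def)
    qed
    show "\<not> realizes M (incl M E) p x" if "x \<in> M" for x
    proof
      assume r: "realizes M (incl M E) p x"
      then have "incl M E x w" "\<not> incl M E x e" by (auto simp: realizes_def p_def)
      \<comment> \<open>A nonempty subset of \<open>w\<close> has an element \<open>c\<close> in
        \<open>W\<close>, hence includes \<open>s c\<close>, which \<open>f c\<close>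
        forbids.\<close>
      then obtain c where c: "c \<in> M" "E c x" "c \<in> W"
        by (auto simp: incl_def W_def)
      then have "sat M (incl M E) (\<lambda>_. x) (f c)" using r by (simp add: realizes_def p_def)
      then show False using c by (simp add: f_def incl_s)
    qed
  qed
qed

text \<open>Variables 0, 1 and 2 serve as the given set, the new set and its element. All others
  keep their values under \<open>\<sigma>\<close>, which is how elements of \<open>M\<close> enter
  although the axioms of \<open>ZFC\<close> and \<open>KP\<close> are parameter-free.\<close>

lemma separation_instance:
  assumes "models M E T" "Separation \<Phi> \<subseteq> T" "\<phi> \<in> \<Phi>" "1 \<notin> fv \<phi>" "range \<sigma> \<subseteq> M"
  obtains b where "b \<in> M"
    "\<And>x. x \<in> M \<Longrightarrow> E x b \<longleftrightarrow> E x (\<sigma> 0) \<and> sat M E (\<sigma>(1 := b, 2 := x)) \<phi>"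
proof -
  have "Exists 1 (Forall 2 (Iff (2 \<^bold>\<in> 1) (Conj (2 \<^bold>\<in> 0) \<phi>))) \<in> Separation \<Phi>"
    unfolding Separation_def using assms(3,4)
    by (intro CollectI exI[of _ 0] exI[of _ 1] exI[of _ 2] exI[of _ \<phi>]) auto
  then have "sat M E \<sigma> (Exists 1 (Forall 2 (Iff (2 \<^bold>\<in> 1) (Conj (2 \<^bold>\<in> 0) \<phi>))))"
    using assms unfolding models_def by blast
  then show thesis using that by auto
qed

text \<open>\<open>Pairing\<close> provides only a superset of each singleton, which separation cuts
  down. Keeping \<open>T\<close> and \<open>\<Phi>\<close> general covers both \<open>ZFC\<close>
  with \<open>pure_fms\<close> and \<open>KP\<close> with \<open>Delta0\<close>.\<close>

lemma models_empty_singletons: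
  assumes m: "models M E T" and sep: "Separation \<Phi> \<subseteq> T" "Delta0 \<subseteq> \<Phi>" and pair: "Pairing \<in> T"
  obtains e s where "e \<in> M" "\<And>c. c \<in> M \<Longrightarrow> \<not> E c e" "\<And>a. a \<in> M \<Longrightarrow> s a \<in> M"
    "\<And>a c. a \<in> M \<Longrightarrow> c \<in> M \<Longrightarrow> E c (s a) \<longleftrightarrow> c = a"
proof -
  obtain d where d: "d \<in> M" using m by (auto simp: models_def)
  have "Neg (2 \<^bold>= 2) \<in> \<Phi>" by (intro subsetD[OF sep(2)] Delta0.intros)
  then obtain e where e: "e \<in> M" "\<And>c. c \<in> M \<Longrightarrow> \<not> E c e"
    using separation_instance[OF m sep(1), of "Neg (2 \<^bold>= 2)" "\<lambda>_. d"] d by auto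
  have "\<exists>s\<in>M. \<forall>c\<in>M. E c s \<longleftrightarrow> c = a" if a: "a \<in> M" for a
  proof -
    have "sat M E (\<lambda>_. a) Pairing" using m pair a by (auto simp: models_def)
    then obtain u where u: "u \<in> M" "E a u" by (auto simp: Pairing_def)
    \<comment> \<open>Variable 3 carries \<open>a\<close>, and variable 0 the superset
      \<open>u\<close>.\<close>
    have "2 \<^bold>= 3 \<in> \<Phi>" by (intro subsetD[OF sep(2)] Delta0.intros)
    then obtain b where "b \<in> M" "\<And>c. c \<in> M \<Longrightarrow> E c b \<longleftrightarrow> E c u \<and> c = a"
      using separation_instance[OF m sep(1), of "2 \<^bold>= 3" "(\<lambda>_. a)(0 := u)"] a u by auto
    then show ?thesis using u by blast
  qed
  then obtain s where "\<And>a. a \<in> M \<Longrightarrow> s a \<in> M \<and> (\<forall>c\<in>M. E c (s a) \<longleftrightarrow> c = a)"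
    by metis
  then show thesis using that e by blast
qed

lemma not_omega1_saturated:
  assumes "models M E T" "Separation \<Phi> \<subseteq> T" "Delta0 \<subseteq> \<Phi>" "Pairing \<in> T"
    and "w \<in> M" "countable {a \<in> M. E a w}" "infinite {a \<in> M. E a w}"
  shows "\<not> omega1_saturated M (incl M E)"
proof -
  obtain e s where "e \<in> M" "\<And>c. c \<in> M \<Longrightarrow> \<not> E c e" "\<And>a. a \<in> M \<Longrightarrow> s a \<in> M"
    "\<And>a c. a \<in> M \<Longrightarrow> c \<in> M \<Longrightarrow> E c (s a) \<longleftrightarrow> c = a"
    using models_empty_singletons[OF assms(1-4)] by metis
  with assms(5-7) obtain A p where "A \<subseteq> M" "countable A" "one_type_over A p"
    "finitely_satisfiable M (incl M E) p" "\<And>x. x \<in> M \<Longrightarrow> \<not> realizes M (incl M E) p x"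
    by (rule omitted_type) blast+
  then show ?thesis unfolding omega1_saturated_def by blast
qed

text \<open>Countable parameter sets are strictly smaller than an uncountable
  \<open>M\<close>.\<close>

lemma saturated_imp_omega1_saturated:
  assumes "uncountable M" "saturated M R"
  shows "omega1_saturated M R"
proof -
  have "A \<prec> M" if "A \<subseteq> M" "countable A" for A
    using that assms(1) by (metis countable_eqpoll eqpoll_sym lesspoll_def subset_imp_lepoll)
  then show ?thesis using assms(2) unfolding saturated_def omega1_saturated_def by blast
qed

text \<open>The variable \<open>y\<close> must differ from the bound variables 4 and 5.\<close>

definition zero_or_succ :: "nat \<Rightarrow> 'a fm" where
  "zero_or_succ y = Disj (Neg (Exists 4 (4 \<^bold>\<in> y)))
     (BEx 4 y (Forall 5 (Iff (5 \<^bold>\<in> y) (Disj (5 \<^bold>\<in> 4) (5 \<^bold>= 4)))))"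

definition natural :: "'a fm" where
  "natural = Conj (zero_or_succ 2) (BAll 3 2 (zero_or_succ 3))"

lemma transitive_model_omega:
  fixes mem :: "'v \<Rightarrow> 'v \<Rightarrow> bool"
  assumes U: "set_universe mem" and trans: "transitive_set mem M" and m: "models M mem ZFC"
  obtains w where "w \<in> M" "countable {a \<in> M. mem a w}" "infinite {a \<in> M. mem a w}"
proof -
  have wf: "wfp mem" and ext: "\<And>x y. (\<And>z. mem z x \<longleftrightarrow> mem z y) \<Longrightarrow> x = y"
    using U by (auto simp: set_universe_def)
  have tr: "\<And>x y. x \<in> M \<Longrightarrow> mem y x \<Longrightarrow> y \<in> M" using trans by (auto simp: transitive_set_def)
  \<comment> \<open>These quantify over the whole universe, where extensionality and
    well-foundedness are available. On elements of \<open>M\<close> they agree with their versions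
    relativized to \<open>M\<close>, by transitivity.\<close>
  define zero where "zero x \<longleftrightarrow> (\<forall>z. \<not> mem z x)" for x
  define succ where "succ y x \<longleftrightarrow> (\<forall>z. mem z x \<longleftrightarrow> mem z y \<or> z = y)" for y x
  define zs where "zs x \<longleftrightarrow> zero x \<or> (\<exists>y. succ y x)" for x
  obtain d where d: "d \<in> M" using m by (auto simp: models_def)
  have "sat M mem (\<lambda>_. d) Infinity" using m d by (auto simp: models_def ZFC_def)
  \<comment> \<open>With the connectives unfolded, the two innermost conjuncts say that, as seen in
    \<open>M\<close>, \<open>y\<close> is the successor of \<open>x\<close>.\<close>
  then have "\<exists>i\<in>M. (\<exists>x\<in>M. mem x i \<and> (\<forall>z\<in>M. \<not> mem z x)) \<and>
      (\<forall>x\<in>M. mem x i \<longrightarrow> (\<exists>y\<in>M. mem y i \<and> (\<forall>z\<in>M.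
        (mem z y \<longrightarrow> mem z x \<or> z = x) \<and> (\<not> mem z x \<and> z \<noteq> x \<or> mem z y))))"
    by (simp add: Infinity_def)
  then obtain i where i: "i \<in> M" and i0: "\<exists>x. x \<in> M \<and> mem x i \<and> (\<forall>z\<in>M. \<not> mem z x)"
    and iS: "\<forall>x\<in>M. mem x i \<longrightarrow> (\<exists>y\<in>M. mem y i \<and> (\<forall>z\<in>M.
        (mem z y \<longrightarrow> mem z x \<or> z = x) \<and> (\<not> mem z x \<and> z \<noteq> x \<or> mem z y)))"
    by (elim bexE conjE, intro that exI conjI)
  have zeroE: "\<exists>x. x \<in> M \<and> mem x i \<and> zero x"
    using i0 tr by (meson zero_def)
  \<comment> \<open>The clause on \<open>n = 0\<close> makes dependent choice start at the empty
    set; at \<open>Suc n\<close> it holds vacuously.\<close>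
  have succE: "\<exists>y. (y \<in> M \<and> mem y i \<and> (Suc n = 0 \<longrightarrow> zero y)) \<and> succ x y"
    if x: "x \<in> M \<and> mem x i \<and> (n = 0 \<longrightarrow> zero x)" for x and n :: nat
  proof -
    obtain y where "y \<in> M" "mem y i" and y: "\<forall>z\<in>M.
        (mem z y \<longrightarrow> mem z x \<or> z = x) \<and> (\<not> mem z x \<and> z \<noteq> x \<or> mem z y)"
      using bspec[OF iS, of x] x by blast
    moreover have "mem z y \<longleftrightarrow> mem z x \<or> z = x" for z
      using bspec[OF y, of z] tr[of y z] tr[of x z] x \<open>y \<in> M\<close> by blast
    ultimately show ?thesis unfolding succ_def by auto
  qed
  obtain f :: "nat \<Rightarrow> 'v" where f: "\<And>n. f n \<in> M \<and> mem (f n) i \<and> (n = 0 \<longrightarrow> zero (f n))"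
      "\<And>n. succ (f n) (f (Suc n))"
    using dependent_nat_choice[of "\<lambda>n x. x \<in> M \<and> mem x i \<and> (n = 0 \<longrightarrow> zero x)" "\<lambda>_. succ",
        OF _ succE] zeroE by auto
  have sat_zs: "sat M mem \<sigma> (zero_or_succ y) \<longleftrightarrow> zs (\<sigma> y)"
    if "\<sigma> y \<in> M" "y \<noteq> 4" "y \<noteq> 5" for \<sigma> and y :: nat
  proof -
    have "zero (\<sigma> y) \<longleftrightarrow> (\<forall>z\<in>M. \<not> mem z (\<sigma> y))" using tr that by (auto simp: zero_def)
    moreover have "succ v (\<sigma> y) \<longleftrightarrow>
        v \<in> M \<and> mem v (\<sigma> y) \<and> (\<forall>z\<in>M. mem z (\<sigma> y) \<longleftrightarrow> mem z v \<or> z = v)" for v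
      unfolding succ_def using tr[of "\<sigma> y"] tr[of v] that(1) by blast
    ultimately show ?thesis using that by (auto simp: zero_or_succ_def zs_def)
  qed
  \<comment> \<open>The set \<open>i\<close> may have elements besides the standard naturals;
    separating by \<open>natural\<close> discards them.\<close>
  have "Separation pure_fms \<subseteq> (ZFC :: 'v fm set)" by (auto simp: ZFC_def)
  moreover have "natural \<in> (pure_fms :: 'v fm set)" "1 \<notin> fv (natural :: 'v fm)"
    by (auto simp: pure_fms_def natural_def zero_or_succ_def)
  ultimately obtain w where w: "w \<in> M"
    and w_iff: "\<And>x. x \<in> M \<Longrightarrow>
      mem x w \<longleftrightarrow> mem x i \<and> sat M mem ((\<lambda>_. i)(1 := w, 2 := x)) natural"
    using separation_instance[OF m, of pure_fms natural "\<lambda>_. i"] i by auto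
  have w_iff: "mem x w \<longleftrightarrow> mem x i \<and> zs x \<and> (\<forall>y. mem y x \<longrightarrow> zs y)" if "x \<in> M" for x
    using w_iff[OF that] that tr[OF that] by (auto simp: natural_def sat_zs)
  have f_w: "mem (f n) w" for n
  proof (induction n)
    case 0
    then show ?case using f(1)[of 0] by (auto simp: w_iff zs_def zero_def)
  next
    case (Suc n)
    have "mem (f n) w \<longrightarrow> zs (f n) \<and> (\<forall>y. mem y (f n) \<longrightarrow> zs y)" using w_iff f(1) by blast
    \<comment> \<open>The elements of \<open>f (Suc n)\<close> are \<open>f n\<close> and the
      elements of \<open>f n\<close>.\<close>
    then have "\<forall>y. mem y (f (Suc n)) \<longrightarrow> zs y" using Suc f(2)[of n] by (auto simp: succ_def)
    moreover have "zs (f (Suc n))" using f(2) by (auto simp: zs_def)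
    ultimately show ?case using w_iff f(1) by blast
  qed
  have range_f: "x \<in> range f" if "zs x" "\<And>y. mem y x \<Longrightarrow> zs y" for x
    using wf that
  proof (induction x rule: wfp_induct_rule)
    case (less x)
    from less.prems(1) consider "zero x" | y where "succ y x" by (auto simp: zs_def)
    then show ?case
    proof cases
      case 1
      then have "x = f 0" using f(1)[of 0] by (auto simp: zero_def intro: ext)
      then show ?thesis by auto
    next
      case 2
      \<comment> \<open>The condition passes from \<open>x\<close> to its predecessor
        \<open>y\<close>, because \<open>y\<close> and all elements of \<open>y\<close> are elements
        of \<open>x\<close>; so looking one level down suffices.\<close>
      then have "mem y x" "\<And>z. mem z y \<Longrightarrow> zs z" using less.prems by (auto simp: succ_def)
      then obtain n where n: "y = f n" using less.IH less.prems(2) by blast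
      have "x = f (Suc n)" using 2 f(2)[of n] n by (auto simp: succ_def intro: ext)
      then show ?thesis by auto
    qed
  qed
  have w_range: "{a \<in> M. mem a w} = range f"
  proof (intro equalityI subsetI)
    fix x assume "x \<in> {a \<in> M. mem a w}"
    then have "zs x" "\<forall>y. mem y x \<longrightarrow> zs y" using w_iff[of x] by auto
    then show "x \<in> range f" using range_f by simp
  qed (use f_w f(1) in auto)
  \<comment> \<open>Each value belongs to all later ones, so a repetition would give a set that is
    an element of itself.\<close>
  have f_mem: "mem (f m) (f (Suc (m + k)))" for m k
    by (induction k) (use f(2) in \<open>auto simp: succ_def\<close>)
  have "f m \<noteq> f n" if "m < n" for m n
  proof
    assume "f m = f n"
    then have "mem (f m) (f m)" using f_mem less_imp_Suc_add[OF that] by metis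
    then show False using wf by (metis wfp_imp_asymp asympD)
  qed
  then have "inj f" by (metis injI linorder_neqE_nat)
  then show thesis using that w w_range by (simp add: finite_image_iff)
qed

theorem theorem13:
  shows "(\<forall>(mem :: 'v \<Rightarrow> 'v \<Rightarrow> bool) (M :: 'v set).
            set_universe mem \<and> transitive_set mem M \<and> uncountable M \<and> models M mem ZFC
            \<longrightarrow> \<not> saturated M (incl M mem))
       \<and> (\<forall>(E :: 'm \<Rightarrow> 'm \<Rightarrow> bool) (M :: 'm set).
            models M E KP
            \<and> (\<exists>w\<in>M. countable {a \<in> M. E a w} \<and> infinite {a \<in> M. E a w})
            \<longrightarrow> \<not> omega1_saturated M (incl M E))"
proof (intro conjI allI impI; elim conjE)
  fix mem :: "'v \<Rightarrow> 'v \<Rightarrow> bool" and M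
  assume M: "set_universe mem" "transitive_set mem M" "uncountable M" "models M mem ZFC"
  obtain w where "w \<in> M" "countable {a \<in> M. mem a w}" "infinite {a \<in> M. mem a w}"
    using transitive_model_omega[OF M(1,2,4)] .
  moreover have "Delta0 \<subseteq> (pure_fms :: 'v fm set)"
  proof
    fix \<phi> :: "'v fm" assume "\<phi> \<in> Delta0"
    then show "\<phi> \<in> pure_fms" by induction (auto simp: pure_fms_def)
  qed
  ultimately have "\<not> omega1_saturated M (incl M mem)"
    by (intro not_omega1_saturated[OF M(4), of pure_fms]) (auto simp: ZFC_def)
  then show "\<not> saturated M (incl M mem)"
    using saturated_imp_omega1_saturated M(3) by blast
next
  fix E :: "'m \<Rightarrow> 'm \<Rightarrow> bool" and M
  assume "models M E KP" "\<exists>w\<in>M. countable {a \<in> M. E a w} \<and> infinite {a \<in> M. E a w}"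
  then show "\<not> omega1_saturated M (incl M E)"
    by (elim bexE conjE, intro not_omega1_saturated[of _ _ KP Delta0]) (auto simp: KP_def)
qed

end
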